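(* Let $I$ be a $k$-ideal of a semiring $S$. Then $I$ is $k$-irreducible in $S$ if and only if the zero ideal $\langle\overline{0}\rangle=I/I$ of $S/I$ is $k$-irreducible in $S/I$.
   Context: A semiring is a commutative semiring $(S,+,0,\cdot,1)$ with multiplicative identity $1$ and additive identity $0$ that is absorbing. An ideal is a nonempty subset closed under addition and under multiplication by elements of $S$. A $k$-ideal is an ideal $I$ such that $x+y\in I$ and $y\in I$ imply $x\in I$. A $k$-ideal $I$ is $k$-irreducible if for all $k$-ideals $A,B$ of the semiring, $A\cap B=I$ implies $A=I$ or $B=I$. For an ideal $I$, $S/I$ denotes the quotient semiring of $S$ by the Bourne congruence $K_I$: $a\,K_I\,b$ iff $a+i=b+j$ for some $i,j\in I$. *)

theory Defs
  imports "HOL-Algebra.Ring"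
begin

text \<open>The degenerate case \<open>\<one> = \<zero>\<close> is allowed: it occurs as the quotient by the improper ideal.\<close>

locale csemiring = semiring S + comm_monoid S for S (structure)

definition semiring_ideal :: "('a, 'm) ring_scheme \<Rightarrow> 'a set \<Rightarrow> bool" where
  "semiring_ideal S I \<longleftrightarrow>
     I \<subseteq> carrier S \<and> I \<noteq> {} \<and>
     (\<forall>x\<in>I. \<forall>y\<in>I. x \<oplus>\<^bsub>S\<^esub> y \<in> I) \<and>
     (\<forall>s\<in>carrier S. \<forall>x\<in>I. s \<otimes>\<^bsub>S\<^esub> x \<in> I)"

definition k_ideal :: "('a, 'm) ring_scheme \<Rightarrow> 'a set \<Rightarrow> bool" where
  "k_ideal S I \<longleftrightarrow>
     semiring_ideal S I \<and>
     (\<forall>x\<in>carrier S. \<forall>y\<in>carrier S. x \<oplus>\<^bsub>S\<^esub> y \<in> I \<longrightarrow> y \<in> I \<longrightarrow> x \<in> I)"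

text \<open>Properness of \<open>I\<close> is not required.\<close>

definition k_irreducible :: "('a, 'm) ring_scheme \<Rightarrow> 'a set \<Rightarrow> bool" where
  "k_irreducible S I \<longleftrightarrow>
     k_ideal S I \<and>
     (\<forall>A B. k_ideal S A \<longrightarrow> k_ideal S B \<longrightarrow> A \<inter> B = I \<longrightarrow> A = I \<or> B = I)"

definition gen_semiring_ideal :: "('a, 'm) ring_scheme \<Rightarrow> 'a set \<Rightarrow> 'a set" where
  "gen_semiring_ideal S X = \<Inter>{J. semiring_ideal S J \<and> X \<subseteq> J}"

definition bourne :: "('a, 'm) ring_scheme \<Rightarrow> 'a set \<Rightarrow> ('a \<times> 'a) set" where
  "bourne S I =
     {(a, b). a \<in> carrier S \<and> b \<in> carrier S \<and> (\<exists>i\<in>I. \<exists>j\<in>I. a \<oplus>\<^bsub>S\<^esub> i = b \<oplus>\<^bsub>S\<^esub> j)}"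

text \<open>
  The unions choose representatives of the two classes; the result does not depend on the
  choice, see \<open>bourne_quotient_mult\<close> and \<open>bourne_quotient_add\<close> below.
\<close>

definition bourne_quotient :: "('a, 'm) ring_scheme \<Rightarrow> 'a set \<Rightarrow> 'a set ring" where
  "bourne_quotient S I =
     \<lparr> carrier = carrier S // bourne S I,
       mult = (\<lambda>A B. \<Union>a\<in>A. \<Union>b\<in>B. bourne S I `` {a \<otimes>\<^bsub>S\<^esub> b}),
       one = bourne S I `` {\<one>\<^bsub>S\<^esub>},
       zero = bourne S I `` {\<zero>\<^bsub>S\<^esub>},
       add = (\<lambda>A B. \<Union>a\<in>A. \<Union>b\<in>B. bourne S I `` {a \<oplus>\<^bsub>S\<^esub> b}) \<rparr>"

context csemiring
begin

lemma semiring_ideal_zero: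
  assumes "semiring_ideal S I"
  shows "\<zero> \<in> I"
proof -
  from assms obtain x where "x \<in> I" "x \<in> carrier S"
    unfolding semiring_ideal_def by blast
  then show ?thesis
    using assms l_null[of x] unfolding semiring_ideal_def by (metis zero_closed)
qed

lemma gen_semiring_ideal_zero: "gen_semiring_ideal S {\<zero>} = {\<zero>}"
proof -
  have "semiring_ideal S {\<zero>}"
    by (auto simp: semiring_ideal_def)
  then show ?thesis
    unfolding gen_semiring_ideal_def by blast
qed

lemma bourne_add:
  assumes I: "semiring_ideal S I"
    and ab: "(a, b) \<in> bourne S I" and cd: "(c, d) \<in> bourne S I"
  shows "(a \<oplus> c, b \<oplus> d) \<in> bourne S I"
proof -
  have sub: "I \<subseteq> carrier S" using I by (simp add: semiring_ideal_def)
  from ab cd obtain i j k l where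
    c: "a \<in> carrier S" "b \<in> carrier S" "c \<in> carrier S" "d \<in> carrier S"
    and m: "i \<in> I" "j \<in> I" "k \<in> I" "l \<in> I"
    and e: "a \<oplus> i = b \<oplus> j" "c \<oplus> k = d \<oplus> l"
    by (auto simp: bourne_def)
  have mc: "i \<in> carrier S" "j \<in> carrier S" "k \<in> carrier S" "l \<in> carrier S"
    using m sub by auto
  have "(a \<oplus> c) \<oplus> (i \<oplus> k) = (a \<oplus> i) \<oplus> (c \<oplus> k)"
    using c mc by (simp add: a_ac)
  also have "\<dots> = (b \<oplus> d) \<oplus> (j \<oplus> l)"
    unfolding e using c mc by (simp add: a_ac)
  finally show ?thesis
    using c m I unfolding bourne_def semiring_ideal_def by auto
qed

lemma equiv_bourne:
  assumes I: "semiring_ideal S I"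
  shows "equiv (carrier S) (bourne S I)"
proof (rule equivI)
  have sub: "I \<subseteq> carrier S" using I by (simp add: semiring_ideal_def)
  show "bourne S I \<subseteq> carrier S \<times> carrier S"
    by (auto simp: bourne_def)
  show "refl_on (carrier S) (bourne S I)"
    using semiring_ideal_zero[OF I] by (auto simp: refl_on_def bourne_def)
  show "sym (bourne S I)"
    unfolding sym_def bourne_def by clarsimp metis
  show "trans (bourne S I)"
  proof (rule transI)
    fix a b c
    assume "(a, b) \<in> bourne S I" "(b, c) \<in> bourne S I"
    then obtain i j k l where
      c: "a \<in> carrier S" "b \<in> carrier S" "c \<in> carrier S"
      and m: "i \<in> I" "j \<in> I" "k \<in> I" "l \<in> I"
      and e: "a \<oplus> i = b \<oplus> j" "b \<oplus> k = c \<oplus> l"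
      by (auto simp: bourne_def)
    have mc: "i \<in> carrier S" "j \<in> carrier S" "k \<in> carrier S" "l \<in> carrier S"
      using m sub by auto
    have "a \<oplus> (i \<oplus> k) = (a \<oplus> i) \<oplus> k" using c mc by (simp add: a_assoc)
    also have "\<dots> = (b \<oplus> k) \<oplus> j" unfolding e(1) using c mc by (simp add: a_ac)
    also have "\<dots> = c \<oplus> (l \<oplus> j)" unfolding e(2) using c mc by (simp add: a_assoc)
    finally show "(a, c) \<in> bourne S I"
      using c m I unfolding bourne_def semiring_ideal_def by blast
  qed
qed

lemma bourne_mult:
  assumes I: "semiring_ideal S I"
    and ab: "(a, b) \<in> bourne S I" and s: "s \<in> carrier S"
  shows "(s \<otimes> a, s \<otimes> b) \<in> bourne S I"
proof -
  have sub: "I \<subseteq> carrier S" using I by (simp add: semiring_ideal_def)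
  from ab obtain i j where
    c: "a \<in> carrier S" "b \<in> carrier S"
    and m: "i \<in> I" "j \<in> I"
    and e: "a \<oplus> i = b \<oplus> j"
    by (auto simp: bourne_def)
  have mc: "i \<in> carrier S" "j \<in> carrier S" using m sub by auto
  have "s \<otimes> a \<oplus> s \<otimes> i = s \<otimes> b \<oplus> s \<otimes> j"
    using c mc s e by (simp flip: r_distr)
  then show ?thesis
    using c m s I unfolding bourne_def semiring_ideal_def by auto
qed

lemma bourne_quotient_add:
  assumes I: "semiring_ideal S I" and "a \<in> carrier S" "b \<in> carrier S"
  shows "bourne S I `` {a} \<oplus>\<^bsub>bourne_quotient S I\<^esub> bourne S I `` {b} = bourne S I `` {a \<oplus> b}"
proof -
  note E = equiv_bourne[OF I]
  have "(\<lambda>a b. bourne S I `` {a \<oplus> b}) respects2 bourne S I"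
    by (intro congruent2I' equiv_class_eq[OF E] bourne_add[OF I])
  from UN_equiv_class2[OF E E this assms(2,3)] show ?thesis
    by (simp add: bourne_quotient_def)
qed

lemma bourne_quotient_mult:
  assumes I: "semiring_ideal S I" and "a \<in> carrier S" "b \<in> carrier S"
  shows "bourne S I `` {a} \<otimes>\<^bsub>bourne_quotient S I\<^esub> bourne S I `` {b} = bourne S I `` {a \<otimes> b}"
proof -
  note E = equiv_bourne[OF I]
  have "(\<lambda>a b. bourne S I `` {a \<otimes> b}) respects2 bourne S I"
  proof (rule congruent2_commuteI[OF E])
    show "bourne S I `` {y \<otimes> z} = bourne S I `` {z \<otimes> y}"
      if "y \<in> carrier S" "z \<in> carrier S" for y z
      using that by (simp add: m_comm)
    show "bourne S I `` {w \<otimes> y} = bourne S I `` {w \<otimes> z}"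
      if "w \<in> carrier S" "(y, z) \<in> bourne S I" for y z w
      using that by (intro equiv_class_eq[OF E] bourne_mult[OF I])
  qed
  from UN_equiv_class2[OF E E this assms(2,3)] show ?thesis
    by (simp add: bourne_quotient_def)
qed

lemma csemiring_bourne_quotient:
  assumes I: "semiring_ideal S I"
  shows "csemiring (bourne_quotient S I)"
proof -
  let ?Q = "bourne_quotient S I" and ?c = "\<lambda>a. bourne S I `` {a}"
  note A = bourne_quotient_add[OF I] and M = bourne_quotient_mult[OF I]
  have car: "X \<in> carrier ?Q \<longleftrightarrow> (\<exists>a\<in>carrier S. X = ?c a)" for X
    by (auto simp: bourne_quotient_def quotient_def)
  have Z: "\<zero>\<^bsub>?Q\<^esub> = ?c \<zero>" and O: "\<one>\<^bsub>?Q\<^esub> = ?c \<one>"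
    by (simp_all add: bourne_quotient_def)
  interpret Q: abelian_monoid ?Q
    by (rule abelian_monoidI) (fastforce simp: car Z A a_ac)+
  interpret Qm: comm_monoid ?Q
    by (rule comm_monoidI) (fastforce simp: car O M m_ac)+
  show ?thesis
    by unfold_locales (auto simp: car Z A M l_distr r_distr)
qed

end

end

theory Submission
  imports Defs
begin

text \<open>
  Pulling back along \<open>S \<rightarrow> S/I\<close> is an injective, intersection-preserving map on subsets of \<open>S/I\<close>.
  It identifies the \<open>k\<close>-ideals of \<open>S/I\<close> with the \<open>k\<close>-ideals of \<open>S\<close> containing \<open>I\<close>, and it
  sends the zero ideal to \<open>I\<close>. In a decomposition \<open>A \<inter> B\<close> of a set containing \<open>I\<close> both \<open>A\<close> and
  \<open>B\<close> contain \<open>I\<close>, so \<open>k\<close>-irreducibility transfers in both directions.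
\<close>

definition bourne_pullback :: "('a, 'm) ring_scheme \<Rightarrow> 'a set \<Rightarrow> 'a set set \<Rightarrow> 'a set" where
  "bourne_pullback S I J = {a \<in> carrier S. bourne S I `` {a} \<in> J}"

lemma bourne_pullback_Int:
  "bourne_pullback S I (J \<inter> K) = bourne_pullback S I J \<inter> bourne_pullback S I K"
  by (auto simp: bourne_pullback_def)

lemma carrier_bourne_quotient: "carrier (bourne_quotient S I) = (\<lambda>a. bourne S I `` {a}) ` carrier S"
  by (auto simp: bourne_quotient_def quotient_def)

text \<open>Every class in \<open>J\<close> has a representative in \<open>carrier S\<close>, so
  \<open>J\<close> is recovered as the image of its pullback under the class map.\<close>

lemma bourne_pullback_eq_iff:
  assumes "J \<subseteq> carrier (bourne_quotient S I)" "K \<subseteq> carrier (bourne_quotient S I)"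
  shows "bourne_pullback S I J = bourne_pullback S I K \<longleftrightarrow> J = K"
proof -
  have "J = (\<lambda>a. bourne S I `` {a}) ` bourne_pullback S I J"
    if "J \<subseteq> carrier (bourne_quotient S I)" for J
    using that unfolding carrier_bourne_quotient bourne_pullback_def by blast
  then show ?thesis
    using assms by metis
qed

lemma k_ideal_subset: "k_ideal S A \<Longrightarrow> A \<subseteq> carrier S"
  by (simp add: k_ideal_def semiring_ideal_def)

context csemiring
begin

lemma bourne_class_eq_iff:
  assumes "semiring_ideal S I" "a \<in> carrier S" "b \<in> carrier S"
  shows "bourne S I `` {a} = bourne S I `` {b} \<longleftrightarrow> (\<exists>i\<in>I. \<exists>j\<in>I. a \<oplus> i = b \<oplus> j)"
  using eq_equiv_class_iff[OF equiv_bourne[OF assms(1)] assms(2,3)] assms(2,3)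
  by (simp add: bourne_def)

text \<open>A \<open>k\<close>-ideal containing \<open>I\<close> is saturated: if
  \<open>a \<oplus> i = b \<oplus> j\<close> with \<open>b \<in> A\<close> and \<open>i\<close>,
  \<open>j\<close> in \<open>I\<close>, then \<open>a \<oplus> i\<close> lies in \<open>A\<close>,
  and the \<open>k\<close>-property cancels \<open>i\<close>.\<close>

lemma bourne_class_mem_quotient_iff:
  assumes I: "semiring_ideal S I" and A: "k_ideal S A" and IA: "I \<subseteq> A" and a: "a \<in> carrier S"
  shows "bourne S I `` {a} \<in> A // bourne S I \<longleftrightarrow> a \<in> A"
proof
  assume "bourne S I `` {a} \<in> A // bourne S I"
  then obtain b where b: "b \<in> A" "bourne S I `` {a} = bourne S I `` {b}"
    by (auto simp: quotient_def)
  have sub: "A \<subseteq> carrier S" using A by (rule k_ideal_subset)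
  obtain i j where ij: "i \<in> I" "j \<in> I" "a \<oplus> i = b \<oplus> j"
    using b bourne_class_eq_iff[OF I a, of b] sub by auto
  have "a \<oplus> i \<in> A"
    using ij b(1) IA A unfolding k_ideal_def semiring_ideal_def by auto
  then show "a \<in> A"
    using ij(1) IA A a sub unfolding k_ideal_def by blast
qed (auto simp: quotient_def)

lemma bourne_pullback_quotient:
  assumes "semiring_ideal S I" "k_ideal S A" "I \<subseteq> A"
  shows "bourne_pullback S I (A // bourne S I) = A"
  using bourne_class_mem_quotient_iff[OF assms] k_ideal_subset[OF assms(2)]
  by (auto simp: bourne_pullback_def)

lemma quotient_subset_carrier:
  assumes "A \<subseteq> carrier S"
  shows "A // bourne S I \<subseteq> carrier (bourne_quotient S I)"
  using assms by (auto simp: bourne_quotient_def quotient_def)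

text \<open>The class map is onto and respects both operations, so each clause of the definition for
  \<open>J\<close> becomes, on representatives, the same clause for the pullback.\<close>

lemma bourne_quotient_k_ideal_iff:
  assumes I: "semiring_ideal S I" and J: "J \<subseteq> carrier (bourne_quotient S I)"
  shows "k_ideal (bourne_quotient S I) J \<longleftrightarrow> k_ideal S (bourne_pullback S I J)"
proof -
  note A = bourne_quotient_add[OF I] and M = bourne_quotient_mult[OF I]
  have ball: "(\<forall>X\<in>J. P X) \<longleftrightarrow> (\<forall>a\<in>bourne_pullback S I J. P (bourne S I `` {a}))" for P
    using J unfolding carrier_bourne_quotient bourne_pullback_def by blast
  \<comment> \<open>A set is empty exactly when \<open>False\<close> holds for all its
    elements.\<close>
  have ne: "J \<noteq> {} \<longleftrightarrow> bourne_pullback S I J \<noteq> {}"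
    using ball[of "\<lambda>_. False"] by blast
  have car: "(\<forall>X\<in>carrier (bourne_quotient S I). P X) \<longleftrightarrow> (\<forall>a\<in>carrier S. P (bourne S I `` {a}))" for P
    by (simp add: carrier_bourne_quotient)
  \<comment> \<open>Quantifying over \<open>carrier S\<close> supplies the premises under which
    \<open>mem\<close>, \<open>A\<close> and \<open>M\<close> rewrite.\<close>
  have ball_pullback: "(\<forall>a\<in>bourne_pullback S I J. P a) \<longleftrightarrow>
      (\<forall>a\<in>carrier S. bourne S I `` {a} \<in> J \<longrightarrow> P a)" for P
    by (auto simp: bourne_pullback_def)
  have mem: "a \<in> bourne_pullback S I J \<longleftrightarrow> bourne S I `` {a} \<in> J" if "a \<in> carrier S" for a
    using that by (simp add: bourne_pullback_def)
  have "bourne_pullback S I J \<subseteq> carrier S"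
    by (auto simp: bourne_pullback_def)
  with J show ?thesis
    unfolding k_ideal_def semiring_ideal_def ball ne car
    by (simp add: ball_pullback mem A M)
qed

text \<open>For \<open>i \<in> I\<close> the equation
  \<open>i \<oplus> \<zero> = \<zero> \<oplus> i\<close> makes \<open>i\<close> congruent to
  \<open>\<zero>\<close>, so all of \<open>I\<close> collapses to one class.\<close>

lemma quotient_self_bourne:
  assumes I: "semiring_ideal S I"
  shows "I // bourne S I = {\<zero>\<^bsub>bourne_quotient S I\<^esub>}"
proof -
  have z: "\<zero> \<in> I" using I by (rule semiring_ideal_zero)
  have "bourne S I `` {i} = bourne S I `` {\<zero>}" if i: "i \<in> I" for i
  proof -
    have ic: "i \<in> carrier S" using i I by (auto simp: semiring_ideal_def)
    then have "\<exists>j\<in>I. \<exists>k\<in>I. i \<oplus> j = \<zero> \<oplus> k"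
      using z i by (intro bexI[of _ \<zero>] bexI[of _ i]) simp_all
    then show ?thesis
      by (simp add: bourne_class_eq_iff[OF I ic])
  qed
  then have "(\<lambda>i. bourne S I `` {i}) ` I = {bourne S I `` {\<zero>}}"
    using z by blast
  moreover have "I // bourne S I = (\<lambda>i. bourne S I `` {i}) ` I"
    by (auto simp: quotient_def)
  ultimately show ?thesis
    by (simp add: bourne_quotient_def)
qed

lemma subset_bourne_pullback:
  assumes I: "semiring_ideal S I" and J: "k_ideal (bourne_quotient S I) J"
  shows "I \<subseteq> bourne_pullback S I J"
proof
  fix i assume i: "i \<in> I"
  interpret Q: csemiring "bourne_quotient S I"
    by (rule csemiring_bourne_quotient[OF I])
  have "bourne S I `` {i} \<in> I // bourne S I"
    using i by (auto simp: quotient_def)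
  then have "bourne S I `` {i} \<in> J"
    using Q.semiring_ideal_zero[of J] J by (simp add: k_ideal_def quotient_self_bourne[OF I])
  then show "i \<in> bourne_pullback S I J"
    using i I by (auto simp: bourne_pullback_def semiring_ideal_def)
qed

text \<open>The correspondence works at any \<open>k\<close>-ideal \<open>J\<close> of the quotient;
  the zero ideal is the case \<open>J = I // bourne S I\<close>, whose pullback is
  \<open>I\<close>.\<close>

lemma bourne_quotient_k_irreducible_iff:
  assumes I: "semiring_ideal S I" and J: "k_ideal (bourne_quotient S I) J"
  shows "k_irreducible S (bourne_pullback S I J) \<longleftrightarrow> k_irreducible (bourne_quotient S I) J"
    (is "?L \<longleftrightarrow> ?R")
proof
  note iff = bourne_quotient_k_ideal_iff[OF I]
  note Jc = k_ideal_subset[OF J]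
  show ?R if L: ?L
    unfolding k_irreducible_def
  proof (intro conjI allI impI J)
    fix A B
    assume A: "k_ideal (bourne_quotient S I) A" and B: "k_ideal (bourne_quotient S I) B"
      and "A \<inter> B = J"
    then have "bourne_pullback S I A \<inter> bourne_pullback S I B = bourne_pullback S I J"
      by (simp flip: bourne_pullback_Int)
    then have "bourne_pullback S I A = bourne_pullback S I J \<or>
        bourne_pullback S I B = bourne_pullback S I J"
      using L A B iff k_ideal_subset unfolding k_irreducible_def by blast
    then show "A = J \<or> B = J"
      using bourne_pullback_eq_iff k_ideal_subset A B Jc by metis
  qed
  show ?L if R: ?R
    unfolding k_irreducible_def
  proof (intro conjI allI impI)
    show "k_ideal S (bourne_pullback S I J)"
      using J iff[OF Jc] by simp
    fix A B
    assume A: "k_ideal S A" and B: "k_ideal S B" and AB: "A \<inter> B = bourne_pullback S I J"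
    let ?A = "A // bourne S I" and ?B = "B // bourne S I"
    \<comment> \<open>Containing \<open>I\<close> makes \<open>A\<close> and \<open>B\<close>
      saturated, hence pullbacks of \<open>?A\<close> and \<open>?B\<close>.\<close>
    have "I \<subseteq> A" "I \<subseteq> B"
      using subset_bourne_pullback[OF I J] AB by auto
    then have pA: "bourne_pullback S I ?A = A" and pB: "bourne_pullback S I ?B = B"
      using bourne_pullback_quotient[OF I] A B by auto
    have cA: "?A \<subseteq> carrier (bourne_quotient S I)" and cB: "?B \<subseteq> carrier (bourne_quotient S I)"
      using quotient_subset_carrier k_ideal_subset A B by blast+
    \<comment> \<open>Taking images need not commute with intersection, so
      \<open>?A \<inter> ?B\<close> is compared with \<open>J\<close> after pulling back, and
      injectivity then gives equality.\<close>
    have "bourne_pullback S I (?A \<inter> ?B) = bourne_pullback S I J"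
      using pA pB AB by (simp add: bourne_pullback_Int)
    then have "?A \<inter> ?B = J"
      using bourne_pullback_eq_iff[of "?A \<inter> ?B" S I J] cA Jc by blast
    moreover have "k_ideal (bourne_quotient S I) ?A" "k_ideal (bourne_quotient S I) ?B"
      using iff[OF cA] iff[OF cB] pA pB A B by simp_all
    ultimately have "?A = J \<or> ?B = J"
      using R unfolding k_irreducible_def by blast
    then show "A = bourne_pullback S I J \<or> B = bourne_pullback S I J"
      using pA pB by metis
  qed
qed

end

theorem theorem4p5:
  fixes S (structure) and I
  assumes "csemiring S" and "k_ideal S I"
  shows "gen_semiring_ideal (bourne_quotient S I) {\<zero>\<^bsub>bourne_quotient S I\<^esub>} = I // bourne S I \<and>
    (k_irreducible S I \<longleftrightarrow>
      k_irreducible (bourne_quotient S I)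
        (gen_semiring_ideal (bourne_quotient S I) {\<zero>\<^bsub>bourne_quotient S I\<^esub>}))"
proof -
  interpret csemiring S by fact
  have I: "semiring_ideal S I" using assms(2) by (simp add: k_ideal_def)
  interpret Q: csemiring "bourne_quotient S I"
    by (rule csemiring_bourne_quotient[OF I])
  have gen: "gen_semiring_ideal (bourne_quotient S I) {\<zero>\<^bsub>bourne_quotient S I\<^esub>} = I // bourne S I"
    by (simp add: Q.gen_semiring_ideal_zero quotient_self_bourne[OF I])
  have pull: "bourne_pullback S I (I // bourne S I) = I"
    using bourne_pullback_quotient[OF I assms(2)] by simp
  \<comment> \<open>The zero ideal is a \<open>k\<close>-ideal because its pullback \<open>I\<close>
    is one.\<close>
  then have "k_ideal (bourne_quotient S I) (I // bourne S I)"
    using bourne_quotient_k_ideal_iff[OF I quotient_subset_carrier] k_ideal_subset assms(2)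
    by metis
  then show ?thesis
    using bourne_quotient_k_irreducible_iff[OF I] gen pull by metis
qed

end
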